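(* Let $\mathbf{A}$ be a small category and let $\mathcal{C}$ be a collection of binary product cones in $\mathbf{A}$. There is a one-to-one correspondence between $(\Sigma_{\mathcal{C}},E_{\mathcal{C}})$-algebras and $\mathcal{C}$-product-preserving functors $F:\mathbf{A}\to\mathbf{Set}$, under which an algebra $\mathcal{T}$ corresponds to the functor given on objects $A$ by the carrier $\mathcal{T}(A)$ and on morphisms $f$ by the operation $\mathcal{T}(f)$. The equations (fst), (snd) and (pair) of $E_{\mathcal{C}}$ are exactly what is required to ensure that, for each cone $A\xleftarrow{\mathsf{fst}}C\xrightarrow{\mathsf{snd}}B$ in $\mathcal{C}$, the cone $F(A)\xleftarrow{F(\mathsf{fst})}F(C)\xrightarrow{F(\mathsf{snd})}F(B)$ is a product cone in $\mathbf{Set}$.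
   Context: A functor $F:\mathbf{A}\to\mathbf{Set}$ is $\mathcal{C}$-product-preserving if for every cone $A\xleftarrow{\mathsf{fst}}C\xrightarrow{\mathsf{snd}}B$ in $\mathcal{C}$, the cone $F(A)\xleftarrow{F(\mathsf{fst})}F(C)\xrightarrow{F(\mathsf{snd})}F(B)$ is a product cone in $\mathbf{Set}$. The multi-sorted theory $(\Sigma_{\mathcal{C}},E_{\mathcal{C}})$: the sorts are the objects of $\mathbf{A}$. The signature $\Sigma_{\mathcal{C}}$ contains a unary function symbol $f:A\to B$ for every morphism $f:A\to B$ of $\mathbf{A}$, and, for each cone $A\xleftarrow{\mathsf{fst}}C\xrightarrow{\mathsf{snd}}B$ in $\mathcal{C}$, a binary function symbol $\mathsf{pair}:A,B\to C$ (one symbol for each cone). For each sort $A$ there is a given countable set $X_A$ of variables of sort $A$, these sets being pairwise disjoint. The equations $E_{\mathcal{C}}$ are: - (id) $\mathrm{id}_A(x)\approx x:A$, for $x$ a variable of sort $A$; - (comp) $(f\circ g)(x)\approx f(g(x)):C$, for morphisms $g:A\to B$, $f:B\to C$ and $x$ a variable of sort $A$; - for each cone $A\xleftarrow{\mathsf{fst}}C\xrightarrow{\mathsf{snd}}B$ in $\mathcal{C}$: (fst) $\mathsf{fst}(\mathsf{pair}(x,y))\approx x:A$ and (snd) $\mathsf{snd}(\mathsf{pair}(x,y))\approx y:B$, for variables $x$ of sort $A$ and $y$ of sort $B$, and (pair) $\mathsf{pair}(\mathsf{fst}(z),\mathsf{snd}(z))\approx z:C$, for a variable $z$ of sort $C$.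 A $\Sigma_{\mathcal{C}}$-algebra $\mathcal{T}$ consists of a set $\mathcal{T}(A)$ (carrier) for each sort $A$ and, for each function symbol $f:A_1,\ldots,A_n\to B$, a function $\mathcal{T}(f):\mathcal{T}(A_1)\times\cdots\times\mathcal{T}(A_n)\to\mathcal{T}(B)$. A homomorphism $\phi:\mathcal{S}\to\mathcal{T}$ of $\Sigma_{\mathcal{C}}$-algebras consists of a function $\phi_A:\mathcal{S}(A)\to\mathcal{T}(A)$ for each sort $A$ such that $\phi_B(\mathcal{S}(f)(a_1,\ldots,a_n))=\mathcal{T}(f)(\phi_{A_1}(a_1),\ldots,\phi_{A_n}(a_n))$ for every function symbol $f:A_1,\ldots,A_n\to B$ and all $a_i\in\mathcal{S}(A_i)$. The open term algebra $\mathrm{Term}(\Sigma_{\mathcal{C}})$ has as carrier at sort $A$ the set of terms of sort $A$ freely generated, in the sort-respecting way, from the variables (of all sorts) and function symbols, with operations $(t_1,\ldots,t_n)\mapsto f(t_1,\ldots,t_n)$. A $\Sigma_{\mathcal{C}}$-algebra $\mathcal{T}$ satisfies an equation $s\approx t:A$ if for every homomorphism $\phi:\mathrm{Term}(\Sigma_{\mathcal{C}})\to\mathcal{T}$ one has $\phi_A(s)=\phi_A(t)$. A $(\Sigma_{\mathcal{C}},E_{\mathcal{C}})$-algebra is a $\Sigma_{\mathcal{C}}$-algebra satisfying all equations in $E_{\mathcal{C}}$.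
   Formalization: Satisfaction uses homomorphisms from terms on the variables of the equation only, since with all variables an empty carrier makes every equation vacuous and the claim false; the literal notion is treated for nonempty carriers. Countable variable sets are taken to be infinite. *)

theory Defs
  imports Main "HOL-Library.FuncSet" "HOL-Library.Disjoint_Sets" "HOL-Library.Countable_Set"
begin

section \<open>Categories, functors and binary product cones\<close>

record ('o, 'm) category =
  Obj :: "'o set"
  Arr :: "'m set"
  Dom :: "'m \<Rightarrow> 'o"
  Cod :: "'m \<Rightarrow> 'o"
  Id :: "'o \<Rightarrow> 'm"
  Comp :: "'m \<Rightarrow> 'm \<Rightarrow> 'm"

text \<open>\<open>Comp A f g\<close> is the composite "f after g".\<close>

locale category =
  fixes A :: "('o, 'm) category"
  assumes Dom_in: "f \<in> Arr A \<Longrightarrow> Dom A f \<in> Obj A"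
    and Cod_in: "f \<in> Arr A \<Longrightarrow> Cod A f \<in> Obj A"
    and Id_in: "a \<in> Obj A \<Longrightarrow> Id A a \<in> Arr A"
    and Dom_Id: "a \<in> Obj A \<Longrightarrow> Dom A (Id A a) = a"
    and Cod_Id: "a \<in> Obj A \<Longrightarrow> Cod A (Id A a) = a"
    and Comp_in: "\<lbrakk>f \<in> Arr A; g \<in> Arr A; Dom A f = Cod A g\<rbrakk> \<Longrightarrow> Comp A f g \<in> Arr A"
    and Dom_Comp: "\<lbrakk>f \<in> Arr A; g \<in> Arr A; Dom A f = Cod A g\<rbrakk> \<Longrightarrow> Dom A (Comp A f g) = Dom A g"
    and Cod_Comp: "\<lbrakk>f \<in> Arr A; g \<in> Arr A; Dom A f = Cod A g\<rbrakk> \<Longrightarrow> Cod A (Comp A f g) = Cod A f"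
    and Comp_Id: "f \<in> Arr A \<Longrightarrow> Comp A f (Id A (Dom A f)) = f"
    and Id_Comp: "f \<in> Arr A \<Longrightarrow> Comp A (Id A (Cod A f)) f = f"
    and Comp_assoc: "\<lbrakk>f \<in> Arr A; g \<in> Arr A; h \<in> Arr A; Dom A f = Cod A g; Dom A g = Cod A h\<rbrakk>
      \<Longrightarrow> Comp A (Comp A f g) h = Comp A f (Comp A g h)"

text \<open>A binary cone is given by its two legs \<open>(p, q)\<close>; the apex is the common domain and the base
  objects are the codomains.\<close>

type_synonym 'm cone = "'m \<times> 'm"

definition product_cone :: "('o, 'm) category \<Rightarrow> 'm cone \<Rightarrow> bool" where
  "product_cone A = (\<lambda>(p, q).
     p \<in> Arr A \<and> q \<in> Arr A \<and> Dom A p = Dom A q \<and>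
     (\<forall>f \<in> Arr A. \<forall>g \<in> Arr A. Dom A f = Dom A g \<and> Cod A f = Cod A p \<and> Cod A g = Cod A q \<longrightarrow>
        (\<exists>!h. h \<in> Arr A \<and> Dom A h = Dom A f \<and> Cod A h = Dom A p \<and>
              Comp A p h = f \<and> Comp A q h = g)))"

record ('o, 'm, 'p, 'n) functor_data =
  fobj :: "'o \<Rightarrow> 'p"
  farr :: "'m \<Rightarrow> 'n"

text \<open>The two maps of a functor are extensional (\<open>undefined\<close> off the source category), so that HOL
  equality of functors is equality on objects and arrows.\<close>

definition cat_functor ::
  "('o, 'm) category \<Rightarrow> ('p, 'n) category \<Rightarrow> ('o, 'm, 'p, 'n) functor_data \<Rightarrow> bool" where
  "cat_functor A B F \<longleftrightarrow>
     fobj F \<in> Obj A \<rightarrow>\<^sub>E Obj B \<and> farr F \<in> Arr A \<rightarrow>\<^sub>E Arr B \<and>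
     (\<forall>f \<in> Arr A. Dom B (farr F f) = fobj F (Dom A f) \<and> Cod B (farr F f) = fobj F (Cod A f)) \<and>
     (\<forall>a \<in> Obj A. farr F (Id A a) = Id B (fobj F a)) \<and>
     (\<forall>f \<in> Arr A. \<forall>g \<in> Arr A. Dom A f = Cod A g \<longrightarrow>
        farr F (Comp A f g) = Comp B (farr F f) (farr F g))"

definition map_cone :: "('o, 'm, 'p, 'n) functor_data \<Rightarrow> 'm cone \<Rightarrow> 'n cone" where
  "map_cone F = (\<lambda>(p, q). (farr F p, farr F q))"

text \<open>The category of sets whose elements lie in the (arbitrary) type \<open>'u\<close>. An arrow
  \<open>(X, f, Y)\<close> is a function with its domain and codomain. Since \<open>'u\<close> is nonempty, one-element
  sets are available, so product cones here are the usual ones even if \<open>'u\<close> is finite.\<close>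

type_synonym 'u set_arr = "'u set \<times> ('u \<Rightarrow> 'u) \<times> 'u set"

definition Set_cat :: "('u set, 'u set_arr) category" where
  "Set_cat = \<lparr>
     Obj = UNIV,
     Arr = {(X, f, Y). f \<in> X \<rightarrow>\<^sub>E Y},
     Dom = (\<lambda>(X, f, Y). X),
     Cod = (\<lambda>(X, f, Y). Y),
     Id = (\<lambda>X. (X, \<lambda>x\<in>X. x, X)),
     Comp = (\<lambda>(Y, g, Z) (X, f, _). (X, compose X g f, Z)) \<rparr>"

lemma category_Set_cat: "category Set_cat"
  by standard
    (auto simp: Set_cat_def compose_def fun_eq_iff PiE_iff Pi_iff extensional_def, metis)

definition product_preserving ::
  "('o, 'm) category \<Rightarrow> 'm cone set \<Rightarrow> ('o, 'm, 'u set, 'u set_arr) functor_data \<Rightarrow> bool" where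
  "product_preserving A C F \<longleftrightarrow>
     cat_functor A Set_cat F \<and> (\<forall>c \<in> C. product_cone Set_cat (map_cone F c))"


section \<open>Multi-sorted algebra\<close>

record ('s, 'f) signature =
  Sorts :: "'s set"
  Syms :: "'f set"
  arity :: "'f \<Rightarrow> 's list"
  res :: "'f \<Rightarrow> 's"

record ('s, 'f, 'a) algebra =
  carrier :: "'s \<Rightarrow> 'a set"
  oper :: "'f \<Rightarrow> 'a list \<Rightarrow> 'a"

definition args :: "('s, 'f) signature \<Rightarrow> ('s, 'f, 'a) algebra \<Rightarrow> 'f \<Rightarrow> 'a list set" where
  "args \<Sigma> T f = listset (map (carrier T) (arity \<Sigma> f))"

text \<open>As for functors, all components of an algebra are extensional.\<close>

definition is_algebra :: "('s, 'f) signature \<Rightarrow> ('s, 'f, 'a) algebra \<Rightarrow> bool" where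
  "is_algebra \<Sigma> T \<longleftrightarrow>
     carrier T \<in> extensional (Sorts \<Sigma>) \<and>
     oper T \<in> (\<Pi>\<^sub>E f\<in>Syms \<Sigma>. args \<Sigma> T f \<rightarrow>\<^sub>E carrier T (res \<Sigma> f))"

definition homomorphism ::
  "('s, 'f) signature \<Rightarrow> ('s, 'f, 'a) algebra \<Rightarrow> ('s, 'f, 'b) algebra \<Rightarrow> ('s \<Rightarrow> 'a \<Rightarrow> 'b) \<Rightarrow> bool" where
  "homomorphism \<Sigma> S T \<phi> \<longleftrightarrow>
     (\<forall>s \<in> Sorts \<Sigma>. \<phi> s \<in> carrier S s \<rightarrow> carrier T s) \<and>
     (\<forall>f \<in> Syms \<Sigma>. \<forall>as \<in> args \<Sigma> S f.
        \<phi> (res \<Sigma> f) (oper S f as) = oper T f (map2 \<phi> (arity \<Sigma> f) as))"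

text \<open>"Countable" must be read as countably infinite: some equations need two distinct variables of
  the same sort.\<close>

definition variable_sets :: "('s, 'f) signature \<Rightarrow> ('s \<Rightarrow> 'v set) \<Rightarrow> bool" where
  "variable_sets \<Sigma> X \<longleftrightarrow>
     (\<forall>s \<in> Sorts \<Sigma>. countable (X s) \<and> infinite (X s)) \<and> disjoint_family_on X (Sorts \<Sigma>)"

datatype (trm_vars: 'v, trm_syms: 'f) trm = Var 'v | App 'f "('v, 'f) trm list"

inductive has_sort :: "('s, 'f) signature \<Rightarrow> ('s \<Rightarrow> 'v set) \<Rightarrow> ('v, 'f) trm \<Rightarrow> 's \<Rightarrow> bool"
  for \<Sigma> :: "('s, 'f) signature" and X :: "'s \<Rightarrow> 'v set" where
  Var: "\<lbrakk>s \<in> Sorts \<Sigma>; x \<in> X s\<rbrakk> \<Longrightarrow> has_sort \<Sigma> X (Var x) s"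
| App: "\<lbrakk>f \<in> Syms \<Sigma>; list_all2 (has_sort \<Sigma> X) ts (arity \<Sigma> f)\<rbrakk> \<Longrightarrow> has_sort \<Sigma> X (App f ts) (res \<Sigma> f)"

definition term_algebra ::
  "('s, 'f) signature \<Rightarrow> ('s \<Rightarrow> 'v set) \<Rightarrow> ('s, 'f, ('v, 'f) trm) algebra" where
  "term_algebra \<Sigma> X = \<lparr>
     carrier = (\<lambda>s\<in>Sorts \<Sigma>. {t. has_sort \<Sigma> X t s}),
     oper = (\<lambda>f\<in>Syms \<Sigma>. \<lambda>ts\<in>{ts. list_all2 (has_sort \<Sigma> X) ts (arity \<Sigma> f)}. App f ts) \<rparr>"

text \<open>\<open>(l, r, s)\<close> stands for the equation between \<open>l\<close> and \<open>r\<close> at sort \<open>s\<close>.\<close>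

type_synonym ('s, 'f, 'v) equation = "('v, 'f) trm \<times> ('v, 'f) trm \<times> 's"

text \<open>\<open>satisfies_open\<close> quantifies over all homomorphisms from the term algebra on \<^emph>\<open>all\<close> variables
  in \<open>X\<close>. If some carrier of \<open>T\<close> is empty there are none (see \<open>satisfies_open_vacuous\<close> below), and
  then every equation holds, so that this notion is adequate only for algebras with nonempty
  carriers. \<open>satisfies\<close> is the same condition for the term algebra on the variables that occur in
  the equation. The two agree if all carriers are nonempty, and \<open>satisfies\<close> is also the right
  notion when some carriers are empty.\<close>

definition satisfies_open ::
  "('s, 'f) signature \<Rightarrow> ('s \<Rightarrow> 'v set) \<Rightarrow> ('s, 'f, 'a) algebra \<Rightarrow> ('s, 'f, 'v) equation \<Rightarrow> bool" where
  "satisfies_open \<Sigma> X T = (\<lambda>(l, r, s).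
     \<forall>\<phi>. homomorphism \<Sigma> (term_algebra \<Sigma> X) T \<phi> \<longrightarrow> \<phi> s l = \<phi> s r)"

definition satisfies ::
  "('s, 'f) signature \<Rightarrow> ('s \<Rightarrow> 'v set) \<Rightarrow> ('s, 'f, 'a) algebra \<Rightarrow> ('s, 'f, 'v) equation \<Rightarrow> bool" where
  "satisfies \<Sigma> X T = (\<lambda>(l, r, s).
     satisfies_open \<Sigma> (\<lambda>s'. X s' \<inter> (trm_vars l \<union> trm_vars r)) T (l, r, s))"

lemma satisfies_open_vacuous:
  assumes "variable_sets \<Sigma> X" and "s \<in> Sorts \<Sigma>" and "carrier T s = {}"
  shows "satisfies_open \<Sigma> X T e"
proof -
  have "X s \<noteq> {}"
    using assms(1,2) by (auto simp: variable_sets_def)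
  then obtain x where "x \<in> X s" by blast
  then have "Var x \<in> carrier (term_algebra \<Sigma> X) s"
    using assms(2) by (auto simp: term_algebra_def intro: has_sort.Var)
  then show ?thesis
    using assms(2,3) by (auto simp: satisfies_open_def homomorphism_def Pi_iff split: prod.splits)
qed


section \<open>The theory of a category with chosen product cones\<close>

datatype 'm sym = Mor 'm | PairOp "'m cone"

definition cone_sig :: "('o, 'm) category \<Rightarrow> 'm cone set \<Rightarrow> ('o, 'm sym) signature" where
  "cone_sig A C = \<lparr>
     Sorts = Obj A,
     Syms = Mor ` Arr A \<union> PairOp ` C,
     arity = (\<lambda>k. case k of Mor f \<Rightarrow> [Dom A f] | PairOp (p, q) \<Rightarrow> [Cod A p, Cod A q]),
     res = (\<lambda>k. case k of Mor f \<Rightarrow> Cod A f | PairOp (p, q) \<Rightarrow> Dom A p) \<rparr>"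

definition id_eqs ::
  "('o, 'm) category \<Rightarrow> ('o \<Rightarrow> 'v set) \<Rightarrow> ('o, 'm sym, 'v) equation set" where
  "id_eqs A X = {(App (Mor (Id A a)) [Var x], Var x, a) | a x. a \<in> Obj A \<and> x \<in> X a}"

definition comp_eqs ::
  "('o, 'm) category \<Rightarrow> ('o \<Rightarrow> 'v set) \<Rightarrow> ('o, 'm sym, 'v) equation set" where
  "comp_eqs A X =
     {(App (Mor (Comp A f g)) [Var x], App (Mor f) [App (Mor g) [Var x]], Cod A f) | f g x.
        f \<in> Arr A \<and> g \<in> Arr A \<and> Dom A f = Cod A g \<and> x \<in> X (Dom A g)}"

definition fst_eqs ::
  "('o, 'm) category \<Rightarrow> ('o \<Rightarrow> 'v set) \<Rightarrow> 'm cone \<Rightarrow> ('o, 'm sym, 'v) equation set" where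
  "fst_eqs A X = (\<lambda>(p, q).
     {(App (Mor p) [App (PairOp (p, q)) [Var x, Var y]], Var x, Cod A p) | x y.
        x \<in> X (Cod A p) \<and> y \<in> X (Cod A q)})"

definition snd_eqs ::
  "('o, 'm) category \<Rightarrow> ('o \<Rightarrow> 'v set) \<Rightarrow> 'm cone \<Rightarrow> ('o, 'm sym, 'v) equation set" where
  "snd_eqs A X = (\<lambda>(p, q).
     {(App (Mor q) [App (PairOp (p, q)) [Var x, Var y]], Var y, Cod A q) | x y.
        x \<in> X (Cod A p) \<and> y \<in> X (Cod A q)})"

definition pair_eqs ::
  "('o, 'm) category \<Rightarrow> ('o \<Rightarrow> 'v set) \<Rightarrow> 'm cone \<Rightarrow> ('o, 'm sym, 'v) equation set" where
  "pair_eqs A X = (\<lambda>(p, q).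
     {(App (PairOp (p, q)) [App (Mor p) [Var z], App (Mor q) [Var z]], Var z, Dom A p) | z.
        z \<in> X (Dom A p)})"

definition cone_eqs ::
  "('o, 'm) category \<Rightarrow> ('o \<Rightarrow> 'v set) \<Rightarrow> 'm cone \<Rightarrow> ('o, 'm sym, 'v) equation set" where
  "cone_eqs A X c = fst_eqs A X c \<union> snd_eqs A X c \<union> pair_eqs A X c"

definition theory_eqs ::
  "('o, 'm) category \<Rightarrow> 'm cone set \<Rightarrow> ('o \<Rightarrow> 'v set) \<Rightarrow> ('o, 'm sym, 'v) equation set" where
  "theory_eqs A C X = id_eqs A X \<union> comp_eqs A X \<union> (\<Union>c\<in>C. cone_eqs A X c)"

definition theory_algebra ::
  "('o, 'm) category \<Rightarrow> 'm cone set \<Rightarrow> ('o \<Rightarrow> 'v set) \<Rightarrow> ('o, 'm sym, 'u) algebra \<Rightarrow> bool" where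
  "theory_algebra A C X T \<longleftrightarrow>
     is_algebra (cone_sig A C) T \<and> (\<forall>e \<in> theory_eqs A C X. satisfies (cone_sig A C) X T e)"

definition theory_algebra_open ::
  "('o, 'm) category \<Rightarrow> 'm cone set \<Rightarrow> ('o \<Rightarrow> 'v set) \<Rightarrow> ('o, 'm sym, 'u) algebra \<Rightarrow> bool" where
  "theory_algebra_open A C X T \<longleftrightarrow>
     is_algebra (cone_sig A C) T \<and> (\<forall>e \<in> theory_eqs A C X. satisfies_open (cone_sig A C) X T e)"

definition algebra_functor ::
  "('o, 'm) category \<Rightarrow> ('o, 'm sym, 'u) algebra \<Rightarrow> ('o, 'm, 'u set, 'u set_arr) functor_data" where
  "algebra_functor A T = \<lparr>
     fobj = (\<lambda>a\<in>Obj A. carrier T a),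
     farr = (\<lambda>f\<in>Arr A.
       (carrier T (Dom A f), \<lambda>u\<in>carrier T (Dom A f). oper T (Mor f) [u], carrier T (Cod A f))) \<rparr>"

end

theory Submission
  imports Defs
begin

text \<open>
  A homomorphism from a term algebra is evaluation under a valuation of the variables, so satisfying
  an equation means that the corresponding identity holds for all elements of the relevant carriers
  (\<open>satisfies_iff_eval\<close>). Read in this way, (id) and (comp) say that carriers and unary operations
  form a functor (\<open>cat_functor_algebra_functor_iff\<close>), while (fst), (snd) and (pair) for a cone
  \<open>(p, q)\<close> say together that \<open>pair\<close> is the two-sided inverse of \<open>z \<mapsto> (p z, q z)\<close>, that is,
  \<open>pair (x, y) = z\<close> iff \<open>p z = x\<close> and \<open>q z = y\<close> (\<open>satisfies_cone_eqs_iff\<close>).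

  A cone of sets is a product iff \<open>z \<mapsto> (p z, q z)\<close> is a bijection onto the Cartesian product
  (\<open>product_cone_Set_cat_iff\<close>). Hence a pairing operation satisfying the cone equations exists
  exactly when the image of the cone is a product, and it is then unique, being the inverse of that
  bijection. Existence gives the algebra of a product-preserving functor (\<open>functor_algebra\<close>),
  uniqueness gives injectivity (\<open>algebra_functor_inj\<close>).

  The variant with homomorphisms out of the full open term algebra reduces to this one, because the
  two notions of satisfaction agree when all carriers are nonempty
  (\<open>satisfies_open_iff_satisfies\<close>). Everything is proved for an arbitrary set of cones, so that
  the last claim, about one cone at a time, is the instance with a singleton.
\<close>

section \<open>Homomorphisms out of a term algebra\<close>

lemma in_listset_iff: "as \<in> listset Bs \<longleftrightarrow> list_all2 (\<in>) as Bs"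
  by (induction Bs arbitrary: as) (auto simp: set_Cons_def list_all2_Cons2)

lemma in_args_iff:
  "as \<in> args \<Sigma> T f \<longleftrightarrow> list_all2 (\<lambda>a s. a \<in> carrier T s) as (arity \<Sigma> f)"
  by (simp add: args_def in_listset_iff list_all2_map2)

lemma oper_in_carrier:
  "\<lbrakk>is_algebra \<Sigma> T; f \<in> Syms \<Sigma>; as \<in> args \<Sigma> T f\<rbrakk> \<Longrightarrow> oper T f as \<in> carrier T (res \<Sigma> f)"
  unfolding is_algebra_def by blast

definition wf_signature :: "('s, 'f) signature \<Rightarrow> bool" where
  "wf_signature \<Sigma> \<longleftrightarrow> (\<forall>f \<in> Syms \<Sigma>. set (arity \<Sigma> f) \<subseteq> Sorts \<Sigma> \<and> res \<Sigma> f \<in> Sorts \<Sigma>)"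

definition valuation ::
  "('s, 'f) signature \<Rightarrow> ('s \<Rightarrow> 'v set) \<Rightarrow> ('s, 'f, 'a) algebra \<Rightarrow> ('v \<Rightarrow> 'a) \<Rightarrow> bool" where
  "valuation \<Sigma> X T v \<longleftrightarrow> (\<forall>s \<in> Sorts \<Sigma>. v \<in> X s \<rightarrow> carrier T s)"

primrec eval :: "('s, 'f, 'a) algebra \<Rightarrow> ('v \<Rightarrow> 'a) \<Rightarrow> ('v, 'f) trm \<Rightarrow> 'a" where
  "eval T v (Var x) = v x"
| "eval T v (App f ts) = oper T f (map (eval T v) ts)"

lemma eval_in_carrier:
  assumes "has_sort \<Sigma> X t s" "is_algebra \<Sigma> T" "valuation \<Sigma> X T v"
  shows "eval T v t \<in> carrier T s"
  using assms(1)
proof induction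
  case (Var s x)
  then show ?case using assms(3) by (auto simp: valuation_def)
next
  case (App f ts)
  have "map (eval T v) ts \<in> args \<Sigma> T f"
    unfolding in_args_iff list_all2_map1 by (rule list_all2_mono[OF App(2)]) simp
  then show ?case using oper_in_carrier[OF assms(2) App(1)] by simp
qed

lemma in_args_term_algebra_iff:
  assumes "wf_signature \<Sigma>" "f \<in> Syms \<Sigma>"
  shows "ts \<in> args \<Sigma> (term_algebra \<Sigma> X) f \<longleftrightarrow> list_all2 (has_sort \<Sigma> X) ts (arity \<Sigma> f)"
proof -
  have "set (arity \<Sigma> f) \<subseteq> Sorts \<Sigma>"
    using assms by (auto simp: wf_signature_def)
  then show ?thesis
    unfolding in_args_iff by (intro list.rel_cong) (auto simp: term_algebra_def)
qed

lemma oper_term_algebra: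
  assumes "f \<in> Syms \<Sigma>" "list_all2 (has_sort \<Sigma> X) ts (arity \<Sigma> f)"
  shows "oper (term_algebra \<Sigma> X) f ts = App f ts"
  using assms by (simp add: term_algebra_def)

lemma homomorphism_eval:
  assumes wf: "wf_signature \<Sigma>" and alg: "is_algebra \<Sigma> T" and v: "valuation \<Sigma> X T v"
  shows "homomorphism \<Sigma> (term_algebra \<Sigma> X) T (\<lambda>_. eval T v)"
  unfolding homomorphism_def
proof (intro conjI ballI)
  fix s assume "s \<in> Sorts \<Sigma>"
  then show "eval T v \<in> carrier (term_algebra \<Sigma> X) s \<rightarrow> carrier T s"
    using eval_in_carrier[OF _ alg v] by (auto simp: term_algebra_def)
next
  fix f ts assume f: "f \<in> Syms \<Sigma>" and "ts \<in> args \<Sigma> (term_algebra \<Sigma> X) f"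
  then have ts: "list_all2 (has_sort \<Sigma> X) ts (arity \<Sigma> f)"
    by (simp add: in_args_term_algebra_iff[OF wf])
  then have "map2 (\<lambda>_. eval T v) (arity \<Sigma> f) ts = map (eval T v) ts"
    by (intro nth_equalityI) (auto dest: list_all2_lengthD)
  with f ts show "eval T v (oper (term_algebra \<Sigma> X) f ts)
      = oper T f (map2 (\<lambda>_. eval T v) (arity \<Sigma> f) ts)"
    by (simp add: oper_term_algebra)
qed

text \<open>Terms are freely generated, so a homomorphism is determined by its values on variables; this
  is the uniqueness half of the freeness of the term algebra, \<open>homomorphism_eval\<close> being the
  existence half.\<close>

lemma homomorphism_eq_eval:
  assumes wf: "wf_signature \<Sigma>" and hom: "homomorphism \<Sigma> (term_algebra \<Sigma> X) T \<phi>"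
    and v: "\<And>s x. \<lbrakk>s \<in> Sorts \<Sigma>; x \<in> X s\<rbrakk> \<Longrightarrow> v x = \<phi> s (Var x)"
    and "has_sort \<Sigma> X t s"
  shows "\<phi> s t = eval T v t"
  using assms(4)
proof induction
  case (Var s x)
  then show ?case by (simp add: v)
next
  case (App f ts)
  have ts: "list_all2 (has_sort \<Sigma> X) ts (arity \<Sigma> f)"
    by (rule list_all2_mono[OF App(2)]) simp
  have "\<phi> (res \<Sigma> f) (App f ts) = oper T f (map2 \<phi> (arity \<Sigma> f) ts)"
    using hom App(1) ts
    unfolding homomorphism_def
    by (metis in_args_term_algebra_iff[OF wf] oper_term_algebra)
  also have "map2 \<phi> (arity \<Sigma> f) ts = map (eval T v) ts"
    using App(2) by (intro nth_equalityI) (auto simp: list_all2_conv_all_nth)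
  finally show ?case by simp
qed

text \<open>Disjointness of the variable sets makes the values of a homomorphism on variables a single
  function of the variable, although a homomorphism is indexed by sorts.\<close>

lemma satisfies_open_iff_eval:
  assumes wf: "wf_signature \<Sigma>" and alg: "is_algebra \<Sigma> T"
    and disj: "disjoint_family_on X (Sorts \<Sigma>)"
    and l: "has_sort \<Sigma> X l s" and r: "has_sort \<Sigma> X r s"
  shows "satisfies_open \<Sigma> X T (l, r, s) \<longleftrightarrow> (\<forall>v. valuation \<Sigma> X T v \<longrightarrow> eval T v l = eval T v r)"
proof
  assume "satisfies_open \<Sigma> X T (l, r, s)"
  then show "\<forall>v. valuation \<Sigma> X T v \<longrightarrow> eval T v l = eval T v r"
    unfolding satisfies_open_def prod.case using homomorphism_eval[OF wf alg, of X] by blast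
next
  assume eq: "\<forall>v. valuation \<Sigma> X T v \<longrightarrow> eval T v l = eval T v r"
  show "satisfies_open \<Sigma> X T (l, r, s)"
    unfolding satisfies_open_def
  proof (clarify)
    fix \<phi> assume hom: "homomorphism \<Sigma> (term_algebra \<Sigma> X) T \<phi>"
    define v where "v x = \<phi> (THE s. s \<in> Sorts \<Sigma> \<and> x \<in> X s) (Var x)" for x
    have v: "v x = \<phi> s (Var x)" if "s \<in> Sorts \<Sigma>" "x \<in> X s" for s x
    proof -
      have "(THE s. s \<in> Sorts \<Sigma> \<and> x \<in> X s) = s"
        using that disj by (intro the_equality) (auto simp: disjoint_family_on_def)
      then show ?thesis by (simp add: v_def)
    qed
    have "valuation \<Sigma> X T v"
      unfolding valuation_def
    proof (intro ballI Pi_I)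
      fix s x assume sx: "s \<in> Sorts \<Sigma>" "x \<in> X s"
      then have "Var x \<in> carrier (term_algebra \<Sigma> X) s"
        by (auto simp: term_algebra_def intro: has_sort.Var)
      then show "v x \<in> carrier T s"
        using hom sx by (auto simp: v homomorphism_def)
    qed
    then have "eval T v l = eval T v r" using eq by blast
    then show "\<phi> s l = \<phi> s r"
      using homomorphism_eq_eval[OF wf hom v] l r by metis
  qed
qed

lemma has_sort_restrict_vars:
  assumes "has_sort \<Sigma> X t s" "trm_vars t \<subseteq> V"
  shows "has_sort \<Sigma> (\<lambda>s. X s \<inter> V) t s"
  using assms
proof induction
  case (Var s x)
  then show ?case by (auto intro: has_sort.Var)
next
  case (App f ts)
  then show ?case
    by (intro has_sort.App) (auto simp: list_all2_conv_all_nth SUP_le_iff)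
qed

lemma satisfies_iff_eval:
  assumes "wf_signature \<Sigma>" "is_algebra \<Sigma> T" "disjoint_family_on X (Sorts \<Sigma>)"
    and "has_sort \<Sigma> X l s" "has_sort \<Sigma> X r s"
  shows "satisfies \<Sigma> X T (l, r, s) \<longleftrightarrow>
    (\<forall>v. valuation \<Sigma> (\<lambda>s. X s \<inter> (trm_vars l \<union> trm_vars r)) T v \<longrightarrow> eval T v l = eval T v r)"
  unfolding satisfies_def prod.case
  using assms by (intro satisfies_open_iff_eval)
    (auto simp: disjoint_family_on_def intro: has_sort_restrict_vars)

lemma eval_cong: "(\<And>x. x \<in> trm_vars t \<Longrightarrow> v x = w x) \<Longrightarrow> eval T v t = eval T w t"
proof (induction t)
  case (App f ts)
  then have "map (eval T v) ts = map (eval T w) ts" by auto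
  then show ?case by (simp only: eval.simps)
qed simp

text \<open>Nonempty carriers allow a valuation of the variables of one equation to be extended to all
  variables, which is what makes the two notions of satisfaction agree.\<close>

lemma satisfies_open_iff_satisfies:
  assumes wf: "wf_signature \<Sigma>" and alg: "is_algebra \<Sigma> T"
    and disj: "disjoint_family_on X (Sorts \<Sigma>)"
    and l: "has_sort \<Sigma> X l s" and r: "has_sort \<Sigma> X r s"
    and ne: "\<And>s. s \<in> Sorts \<Sigma> \<Longrightarrow> carrier T s \<noteq> {}"
  shows "satisfies_open \<Sigma> X T (l, r, s) \<longleftrightarrow> satisfies \<Sigma> X T (l, r, s)"
proof -
  define V where "V = trm_vars l \<union> trm_vars r"
  have ext: "\<exists>w. valuation \<Sigma> X T w \<and> (\<forall>x\<in>V. (\<exists>s\<in>Sorts \<Sigma>. x \<in> X s) \<longrightarrow> w x = v x)"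
    if "valuation \<Sigma> (\<lambda>s. X s \<inter> V) T v" for v
  proof -
    have "\<exists>u. \<forall>s\<in>Sorts \<Sigma>. x \<in> X s \<longrightarrow> u \<in> carrier T s" for x
    proof (cases "\<exists>s\<in>Sorts \<Sigma>. x \<in> X s")
      case True
      then obtain s where s: "s \<in> Sorts \<Sigma>" "x \<in> X s" by blast
      then have "s' = s" if "s' \<in> Sorts \<Sigma>" "x \<in> X s'" for s'
        using disj that by (auto simp: disjoint_family_on_def)
      then show ?thesis using ne[OF s(1)] by blast
    qed blast
    then obtain d where d: "\<And>x s. \<lbrakk>s \<in> Sorts \<Sigma>; x \<in> X s\<rbrakk> \<Longrightarrow> d x \<in> carrier T s"
      by metis
    let ?w = "\<lambda>x. if x \<in> V then v x else d x"
    have "valuation \<Sigma> X T ?w"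
      using that d by (auto simp: valuation_def Pi_iff)
    then show ?thesis by (intro exI[of _ ?w]) auto
  qed
  have vars: "\<exists>s\<in>Sorts \<Sigma>. x \<in> X s" if "has_sort \<Sigma> X t s" "x \<in> trm_vars t" for x t s
    using that by induction (auto simp: list_all2_conv_all_nth in_set_conv_nth)
  show ?thesis
    unfolding satisfies_open_iff_eval[OF wf alg disj l r] satisfies_iff_eval[OF wf alg disj l r]
      V_def[symmetric]
  proof
    assume eq: "\<forall>v. valuation \<Sigma> X T v \<longrightarrow> eval T v l = eval T v r"
    show "\<forall>v. valuation \<Sigma> (\<lambda>s. X s \<inter> V) T v \<longrightarrow> eval T v l = eval T v r"
    proof (intro allI impI)
      fix v assume "valuation \<Sigma> (\<lambda>s. X s \<inter> V) T v"
      then obtain w where w: "valuation \<Sigma> X T w"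
        and "\<forall>x\<in>V. (\<exists>s\<in>Sorts \<Sigma>. x \<in> X s) \<longrightarrow> w x = v x"
        using ext by blast
      then have "eval T w l = eval T v l" "eval T w r = eval T v r"
        using vars[OF l] vars[OF r] by (auto simp: V_def intro!: eval_cong)
      with eq w show "eval T v l = eval T v r" by metis
    qed
  next
    assume "\<forall>v. valuation \<Sigma> (\<lambda>s. X s \<inter> V) T v \<longrightarrow> eval T v l = eval T v r"
    then show "\<forall>v. valuation \<Sigma> X T v \<longrightarrow> eval T v l = eval T v r"
      by (auto simp: valuation_def)
  qed
qed

section \<open>Product cones of sets\<close>

lemma product_cone_universal:
  assumes "product_cone A (p, q)" "f \<in> Arr A" "g \<in> Arr A" "Dom A f = Dom A g"
    "Cod A f = Cod A p" "Cod A g = Cod A q"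
  shows "\<exists>!h. h \<in> Arr A \<and> Dom A h = Dom A f \<and> Cod A h = Dom A p \<and>
    Comp A p h = f \<and> Comp A q h = g"
  using assms unfolding product_cone_def prod.case by blast

text \<open>Elements of a set correspond to arrows into it from a one-point set; testing the universal
  property there gives the bijection onto the Cartesian product. The point \<open>(x, y)\<close> is tested with \<open>{x}\<close>,
  which is a one-point set over any element type.\<close>

lemma product_cone_Set_cat_iff:
  "product_cone Set_cat ((Z, P, X), (Z, Q, Y)) \<longleftrightarrow>
     P \<in> Z \<rightarrow>\<^sub>E X \<and> Q \<in> Z \<rightarrow>\<^sub>E Y \<and>
     (\<forall>x \<in> X. \<forall>y \<in> Y. \<exists>!z. z \<in> Z \<and> P z = x \<and> Q z = y)"
  (is "?cone \<longleftrightarrow> ?P \<and> ?Q \<and> ?bij")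
proof
  assume cone: ?cone
  then have P: ?P and Q: ?Q
    by (auto simp: product_cone_def Set_cat_def)
  have ?bij
  proof (intro ballI)
    fix x y assume x: "x \<in> X" and y: "y \<in> Y"
    define f where "f = ({x}, \<lambda>u\<in>{x}. x, X)"
    define g where "g = ({x}, \<lambda>u\<in>{x}. y, Y)"
    have fg: "f \<in> Arr Set_cat" "g \<in> Arr Set_cat" "Dom Set_cat f = {x}" "Dom Set_cat g = {x}"
      "Cod Set_cat f = X" "Cod Set_cat g = Y"
      using x y by (auto simp: Set_cat_def f_def g_def)
    have leg: "Dom Set_cat (Z, P, X) = Z" "Cod Set_cat (Z, P, X) = X" "Cod Set_cat (Z, Q, Y) = Y"
      by (simp_all add: Set_cat_def)
    have ex1h: "\<exists>!h. h \<in> Arr Set_cat \<and> Dom Set_cat h = {x} \<and> Cod Set_cat h = Z \<and>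
        Comp Set_cat (Z, P, X) h = f \<and> Comp Set_cat (Z, Q, Y) h = g"
      using product_cone_universal[OF cone fg(1,2)] unfolding leg fg by simp
    \<comment> \<open>\<open>K k\<close>: the function \<open>k\<close> picks a point of \<open>Z\<close> lying over \<open>(x, y)\<close>.\<close>
    define K where "K k \<longleftrightarrow> k \<in> {x} \<rightarrow>\<^sub>E Z \<and> compose {x} P k = (\<lambda>u\<in>{x}. x)
      \<and> compose {x} Q k = (\<lambda>u\<in>{x}. y)" for k
    have "h \<in> Arr Set_cat \<and> Dom Set_cat h = {x} \<and> Cod Set_cat h = Z \<and>
        Comp Set_cat (Z, P, X) h = f \<and> Comp Set_cat (Z, Q, Y) h = g \<longleftrightarrow>
        (\<exists>k. h = ({x}, k, Z) \<and> K k)" for h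
      by (cases h) (auto simp: Set_cat_def f_def g_def K_def)
    then have "\<exists>!h. \<exists>k. h = ({x}, k, Z) \<and> K k" using ex1h by simp
    then have ex1: "\<exists>!k. K k" by blast
    have K_iff: "K (\<lambda>u\<in>{x}. z) \<longleftrightarrow> z \<in> Z \<and> P z = x \<and> Q z = y" for z
      by (auto simp: K_def compose_def fun_eq_iff)
    have const: "k = (\<lambda>u\<in>{x}. k x)" if "K k" for k
      using that by (auto simp: K_def fun_eq_iff)
    show "\<exists>!z. z \<in> Z \<and> P z = x \<and> Q z = y"
    proof (rule ex_ex1I)
      obtain k where "K k" using ex1 by blast
      then have "K (\<lambda>u\<in>{x}. k x)" using const by metis
      then show "\<exists>z. z \<in> Z \<and> P z = x \<and> Q z = y" unfolding K_iff by blast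
    next
      fix z w assume "z \<in> Z \<and> P z = x \<and> Q z = y" "w \<in> Z \<and> P w = x \<and> Q w = y"
      then have "K (\<lambda>u\<in>{x}. z)" "K (\<lambda>u\<in>{x}. w)" unfolding K_iff .
      with ex1 have "(\<lambda>u\<in>{x}. z) = (\<lambda>u\<in>{x}. w)" by (metis (mono_tags))
      then show "z = w" by (metis restrict_apply' singletonI)
    qed
  qed
  with P Q show "?P \<and> ?Q \<and> ?bij" by blast
next
  assume "?P \<and> ?Q \<and> ?bij"
  then have P: ?P and Q: ?Q and bij: ?bij by blast+
  have "\<exists>!h. h \<in> Arr Set_cat \<and> Dom Set_cat h = W \<and> Cod Set_cat h = Z \<and>
      Comp Set_cat (Z, P, X) h = (W, f, X) \<and> Comp Set_cat (Z, Q, Y) h = (W, g, Y)"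
    if f: "f \<in> W \<rightarrow>\<^sub>E X" and g: "g \<in> W \<rightarrow>\<^sub>E Y" for W f g
  proof -
    have "\<forall>w\<in>W. \<exists>!z. z \<in> Z \<and> P z = f w \<and> Q z = g w"
      using bij f g by blast
    then obtain k where k: "\<And>w. w \<in> W \<Longrightarrow> k w \<in> Z \<and> P (k w) = f w \<and> Q (k w) = g w"
      and uniq: "\<And>w z. \<lbrakk>w \<in> W; z \<in> Z; P z = f w; Q z = g w\<rbrakk> \<Longrightarrow> z = k w"
      by metis
    show ?thesis
    proof (rule ex1I[of _ "(W, restrict k W, Z)"])
      show "(W, restrict k W, Z) \<in> Arr Set_cat \<and> Dom Set_cat (W, restrict k W, Z) = W \<and>
          Cod Set_cat (W, restrict k W, Z) = Z \<and>
          Comp Set_cat (Z, P, X) (W, restrict k W, Z) = (W, f, X) \<and>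
          Comp Set_cat (Z, Q, Y) (W, restrict k W, Z) = (W, g, Y)"
        using k PiE_arb[OF f] PiE_arb[OF g] by (auto simp: Set_cat_def compose_def fun_eq_iff)
    next
      fix h assume h: "h \<in> Arr Set_cat \<and> Dom Set_cat h = W \<and> Cod Set_cat h = Z \<and>
          Comp Set_cat (Z, P, X) h = (W, f, X) \<and> Comp Set_cat (Z, Q, Y) h = (W, g, Y)"
      then obtain h' where h': "h = (W, h', Z)" "h' \<in> W \<rightarrow>\<^sub>E Z"
        and "compose W P h' = f" "compose W Q h' = g"
        by (cases h) (auto simp: Set_cat_def)
      then have "h' w = k w" if "w \<in> W" for w
        using that by (intro uniq) (auto simp: compose_def)
      then have "h' = restrict k W"
        using PiE_arb[OF h'(2)] by (auto simp: fun_eq_iff)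
      then show "h = (W, restrict k W, Z)" using h'(1) by simp
    qed
  qed
  note factors = this
  show ?cone
    unfolding product_cone_def prod.case
  proof (intro conjI ballI impI)
    fix f g
    assume f: "f \<in> Arr Set_cat" and g: "g \<in> Arr Set_cat"
      and bd: "Dom Set_cat f = Dom Set_cat g \<and> Cod Set_cat f = Cod Set_cat (Z, P, X) \<and>
        Cod Set_cat g = Cod Set_cat (Z, Q, Y)"
    obtain W f' g' where fg: "f = (W, f', X)" "g = (W, g', Y)"
      using bd by (cases f, cases g) (simp add: Set_cat_def)
    have fg': "f' \<in> W \<rightarrow>\<^sub>E X" "g' \<in> W \<rightarrow>\<^sub>E Y"
      using f g fg by (simp_all add: Set_cat_def)
    have dom: "Dom Set_cat (W, f', X) = W" "Dom Set_cat (Z, P, X) = Z"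
      by (simp_all add: Set_cat_def)
    show "\<exists>!h. h \<in> Arr Set_cat \<and> Dom Set_cat h = Dom Set_cat f \<and>
        Cod Set_cat h = Dom Set_cat (Z, P, X) \<and>
        Comp Set_cat (Z, P, X) h = f \<and> Comp Set_cat (Z, Q, Y) h = g"
      unfolding fg dom using factors[OF fg'] .
  qed (use P Q in \<open>simp_all add: Set_cat_def\<close>)
qed

section \<open>The equations of the theory, read in an algebra\<close>

locale cone_theory = category A for A :: "('o, 'm) category" +
  fixes C :: "'m cone set" and X :: "'o \<Rightarrow> 'v set"
  assumes legs: "(p, q) \<in> C \<Longrightarrow> p \<in> Arr A \<and> q \<in> Arr A \<and> Dom A q = Dom A p"
    and vars: "variable_sets (cone_sig A C) X"
begin

abbreviation \<Sigma> where "\<Sigma> \<equiv> cone_sig A C"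

lemma sig_simps [simp]:
  "Sorts \<Sigma> = Obj A"
  "Mor f \<in> Syms \<Sigma> \<longleftrightarrow> f \<in> Arr A"
  "PairOp c \<in> Syms \<Sigma> \<longleftrightarrow> c \<in> C"
  "arity \<Sigma> (Mor f) = [Dom A f]"
  "arity \<Sigma> (PairOp (p, q)) = [Cod A p, Cod A q]"
  "res \<Sigma> (Mor f) = Cod A f"
  "res \<Sigma> (PairOp (p, q)) = Dom A p"
  by (auto simp: cone_sig_def)

lemma Syms_cases [consumes 1, case_names Mor PairOp]:
  assumes "k \<in> Syms \<Sigma>"
  obtains f where "k = Mor f" "f \<in> Arr A"
  | p q where "k = PairOp (p, q)" "(p, q) \<in> C"
  using assms by (auto simp: cone_sig_def)

lemma wf_signature: "wf_signature \<Sigma>"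
  unfolding wf_signature_def
proof
  fix k assume "k \<in> Syms \<Sigma>"
  then show "set (arity \<Sigma> k) \<subseteq> Sorts \<Sigma> \<and> res \<Sigma> k \<in> Sorts \<Sigma>"
    by (cases rule: Syms_cases) (auto dest: legs Dom_in Cod_in)
qed

lemma vars_nonempty: "a \<in> Obj A \<Longrightarrow> \<exists>x. x \<in> X a"
  using vars infinite_imp_nonempty by (auto simp: variable_sets_def ex_in_conv)

lemma vars_distinct:
  assumes "a \<in> Obj A" "b \<in> Obj A"
  obtains x y where "x \<in> X a" "y \<in> X b" "x \<noteq> y"
proof -
  obtain x where x: "x \<in> X a" using vars_nonempty assms(1) by blast
  have "infinite (X b - {x})"
    using vars assms(2) by (simp add: variable_sets_def)
  then obtain y where "y \<in> X b - {x}" using infinite_imp_nonempty by blast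
  with x show thesis using that by blast
qed

lemma vars_disjoint: "disjoint_family_on X (Sorts \<Sigma>)"
  using vars by (simp add: variable_sets_def)

lemma vars_unique: "\<lbrakk>a \<in> Obj A; b \<in> Obj A; x \<in> X a; x \<in> X b\<rbrakk> \<Longrightarrow> a = b"
  using vars_disjoint by (auto simp: disjoint_family_on_def)

lemma has_sort_Mor:
  "\<lbrakk>f \<in> Arr A; has_sort \<Sigma> X t (Dom A f)\<rbrakk> \<Longrightarrow> has_sort \<Sigma> X (App (Mor f) [t]) (Cod A f)"
  using has_sort.App[of "Mor f" \<Sigma> X "[t]"] by simp

lemma has_sort_PairOp:
  "\<lbrakk>(p, q) \<in> C; has_sort \<Sigma> X t (Cod A p); has_sort \<Sigma> X u (Cod A q)\<rbrakk>
    \<Longrightarrow> has_sort \<Sigma> X (App (PairOp (p, q)) [t, u]) (Dom A p)"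
  using has_sort.App[of "PairOp (p, q)" \<Sigma> X "[t, u]"] by simp

lemma has_sort_Var: "\<lbrakk>a \<in> Obj A; x \<in> X a\<rbrakk> \<Longrightarrow> has_sort \<Sigma> X (Var x) a"
  by (simp add: has_sort.Var)

lemma id_eqs_sorted:
  "(l, r, s) \<in> id_eqs A X \<Longrightarrow> has_sort \<Sigma> X l s \<and> has_sort \<Sigma> X r s"
  using has_sort_Mor[OF Id_in]
  by (fastforce simp: id_eqs_def Dom_Id Cod_Id intro: has_sort_Var)

lemma comp_eqs_sorted:
  assumes "(l, r, s) \<in> comp_eqs A X"
  shows "has_sort \<Sigma> X l s \<and> has_sort \<Sigma> X r s"
proof -
  obtain f g x where e: "l = App (Mor (Comp A f g)) [Var x]"
      "r = App (Mor f) [App (Mor g) [Var x]]" "s = Cod A f"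
    and fg: "f \<in> Arr A" "g \<in> Arr A" "Dom A f = Cod A g" and x: "x \<in> X (Dom A g)"
    using assms by (auto simp: comp_eqs_def)
  have v: "has_sort \<Sigma> X (Var x) (Dom A g)"
    using fg x by (simp add: has_sort_Var Dom_in)
  show ?thesis
    using has_sort_Mor[OF Comp_in[OF fg]] has_sort_Mor[OF fg(1)] has_sort_Mor[OF fg(2) v] v fg e
    by (simp add: Dom_Comp Cod_Comp)
qed

lemma cone_eqs_sorted:
  assumes c: "(p, q) \<in> C" and e: "(l, r, s) \<in> cone_eqs A X (p, q)"
  shows "has_sort \<Sigma> X l s \<and> has_sort \<Sigma> X r s"
proof -
  note pq = legs[OF c]
  then have obj: "Dom A p \<in> Obj A" "Cod A p \<in> Obj A" "Cod A q \<in> Obj A"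
    by (auto intro: Dom_in Cod_in)
  show ?thesis
    using e pq obj c unfolding cone_eqs_def fst_eqs_def snd_eqs_def pair_eqs_def
    by (auto intro!: has_sort_Var has_sort_PairOp has_sort_Mor)
qed

lemma theory_eqs_sorted:
  "(l, r, s) \<in> theory_eqs A C X \<Longrightarrow> has_sort \<Sigma> X l s \<and> has_sort \<Sigma> X r s"
  unfolding theory_eqs_def using id_eqs_sorted comp_eqs_sorted cone_eqs_sorted by fast

text \<open>By disjointness a variable has a single sort, so valuing the variables of an equation amounts
  to choosing one element of one carrier for each of them.\<close>

lemma satisfies_one_var:
  assumes "is_algebra \<Sigma> T" "has_sort \<Sigma> X l s \<and> has_sort \<Sigma> X r s"
    and x: "a \<in> Obj A" "x \<in> X a" and V: "trm_vars l \<union> trm_vars r = {x}"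
  shows "satisfies \<Sigma> X T (l, r, s) \<longleftrightarrow> (\<forall>v. v x \<in> carrier T a \<longrightarrow> eval T v l = eval T v r)"
proof -
  have "valuation \<Sigma> (\<lambda>s. X s \<inter> {x}) T v \<longleftrightarrow> v x \<in> carrier T a" for v
    using x vars_unique by (fastforce simp: valuation_def Pi_iff)
  with assms show ?thesis
    by (simp add: satisfies_iff_eval[OF wf_signature _ vars_disjoint])
qed

lemma satisfies_two_vars:
  assumes "is_algebra \<Sigma> T" "has_sort \<Sigma> X l s \<and> has_sort \<Sigma> X r s"
    and x: "a \<in> Obj A" "x \<in> X a" and y: "b \<in> Obj A" "y \<in> X b"
    and V: "trm_vars l \<union> trm_vars r = {x, y}"
  shows "satisfies \<Sigma> X T (l, r, s) \<longleftrightarrow>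
    (\<forall>v. v x \<in> carrier T a \<and> v y \<in> carrier T b \<longrightarrow> eval T v l = eval T v r)"
proof -
  have "valuation \<Sigma> (\<lambda>s. X s \<inter> {x, y}) T v \<longleftrightarrow> v x \<in> carrier T a \<and> v y \<in> carrier T b" for v
    using x y vars_unique by (fastforce simp: valuation_def Pi_iff)
  with assms show ?thesis
    by (simp add: satisfies_iff_eval[OF wf_signature _ vars_disjoint])
qed

lemma satisfies_id_eqs_iff:
  assumes alg: "is_algebra \<Sigma> T"
  shows "(\<forall>e \<in> id_eqs A X. satisfies \<Sigma> X T e) \<longleftrightarrow>
    (\<forall>a \<in> Obj A. \<forall>u \<in> carrier T a. oper T (Mor (Id A a)) [u] = u)"
proof -
  have "satisfies \<Sigma> X T (App (Mor (Id A a)) [Var x], Var x, a) \<longleftrightarrow>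
      (\<forall>u \<in> carrier T a. oper T (Mor (Id A a)) [u] = u)" if "a \<in> Obj A" "x \<in> X a" for a x
    using that
    by (subst satisfies_one_var[OF alg id_eqs_sorted that])
      (auto simp: id_eqs_def dest: spec[where x = "\<lambda>_. _"])
  then show ?thesis
    using vars_nonempty unfolding id_eqs_def by fast
qed

lemma satisfies_comp_eqs_iff:
  assumes alg: "is_algebra \<Sigma> T"
  shows "(\<forall>e \<in> comp_eqs A X. satisfies \<Sigma> X T e) \<longleftrightarrow>
    (\<forall>f \<in> Arr A. \<forall>g \<in> Arr A. Dom A f = Cod A g \<longrightarrow> (\<forall>u \<in> carrier T (Dom A g).
       oper T (Mor (Comp A f g)) [u] = oper T (Mor f) [oper T (Mor g) [u]]))"
proof -
  have *: "satisfies \<Sigma> X T (App (Mor (Comp A f g)) [Var x], App (Mor f) [App (Mor g) [Var x]], Cod A f)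
      \<longleftrightarrow> (\<forall>u \<in> carrier T (Dom A g).
        oper T (Mor (Comp A f g)) [u] = oper T (Mor f) [oper T (Mor g) [u]])"
    if "f \<in> Arr A" "g \<in> Arr A" "Dom A f = Cod A g" "x \<in> X (Dom A g)" for f g x
    using that
    by (subst satisfies_one_var[OF alg comp_eqs_sorted Dom_in that(4)])
      (auto simp: comp_eqs_def dest: spec[where x = "\<lambda>_. _"])
  show ?thesis
  proof
    assume all: "\<forall>e \<in> comp_eqs A X. satisfies \<Sigma> X T e"
    show "\<forall>f \<in> Arr A. \<forall>g \<in> Arr A. Dom A f = Cod A g \<longrightarrow> (\<forall>u \<in> carrier T (Dom A g).
       oper T (Mor (Comp A f g)) [u] = oper T (Mor f) [oper T (Mor g) [u]])"
    proof (intro ballI impI)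
      fix f g u assume fg: "f \<in> Arr A" "g \<in> Arr A" "Dom A f = Cod A g" "u \<in> carrier T (Dom A g)"
      obtain x where x: "x \<in> X (Dom A g)" using vars_nonempty[OF Dom_in[OF fg(2)]] by blast
      then have "satisfies \<Sigma> X T
          (App (Mor (Comp A f g)) [Var x], App (Mor f) [App (Mor g) [Var x]], Cod A f)"
        using all fg unfolding comp_eqs_def by blast
      with * fg x show "oper T (Mor (Comp A f g)) [u] = oper T (Mor f) [oper T (Mor g) [u]]"
        by blast
    qed
  next
    assume "\<forall>f \<in> Arr A. \<forall>g \<in> Arr A. Dom A f = Cod A g \<longrightarrow> (\<forall>u \<in> carrier T (Dom A g).
       oper T (Mor (Comp A f g)) [u] = oper T (Mor f) [oper T (Mor g) [u]])"
    with * show "\<forall>e \<in> comp_eqs A X. satisfies \<Sigma> X T e"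
      unfolding comp_eqs_def by blast
  qed
qed

lemma oper_Mor_in:
  "\<lbrakk>is_algebra \<Sigma> T; f \<in> Arr A; u \<in> carrier T (Dom A f)\<rbrakk> \<Longrightarrow> oper T (Mor f) [u] \<in> carrier T (Cod A f)"
  using oper_in_carrier[of \<Sigma> T "Mor f" "[u]"] by (simp add: in_args_iff)

lemma oper_PairOp_in:
  "\<lbrakk>is_algebra \<Sigma> T; (p, q) \<in> C; x \<in> carrier T (Cod A p); y \<in> carrier T (Cod A q)\<rbrakk>
    \<Longrightarrow> oper T (PairOp (p, q)) [x, y] \<in> carrier T (Dom A p)"
  using oper_in_carrier[of \<Sigma> T "PairOp (p, q)" "[x, y]"] by (simp add: in_args_iff)

text \<open>(fst) and (snd) make pairing a right inverse of \<open>z \<mapsto> (p z, q z)\<close>, and (pair) makes it a left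
  inverse. Describing the inverse by its graph lets the product property and the uniqueness of
  pairing both be read off directly.\<close>

lemma satisfies_cone_eqs_iff:
  assumes alg: "is_algebra \<Sigma> T" and c: "(p, q) \<in> C"
  shows "(\<forall>e \<in> cone_eqs A X (p, q). satisfies \<Sigma> X T e) \<longleftrightarrow>
    (\<forall>x \<in> carrier T (Cod A p). \<forall>y \<in> carrier T (Cod A q). \<forall>z \<in> carrier T (Dom A p).
       oper T (PairOp (p, q)) [x, y] = z \<longleftrightarrow> oper T (Mor p) [z] = x \<and> oper T (Mor q) [z] = y)"
  (is "_ \<longleftrightarrow> ?graph")
proof -
  note pq = legs[OF c]
  then have obj: "Dom A p \<in> Obj A" "Cod A p \<in> Obj A" "Cod A q \<in> Obj A"
    by (auto intro: Dom_in Cod_in)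
  let ?pair = "\<lambda>x y. oper T (PairOp (p, q)) [x, y]"
  let ?fst = "\<forall>x \<in> carrier T (Cod A p). \<forall>y \<in> carrier T (Cod A q). oper T (Mor p) [?pair x y] = x"
  let ?snd = "\<forall>x \<in> carrier T (Cod A p). \<forall>y \<in> carrier T (Cod A q). oper T (Mor q) [?pair x y] = y"
  let ?eta = "\<forall>z \<in> carrier T (Dom A p). ?pair (oper T (Mor p) [z]) (oper T (Mor q) [z]) = z"
  have sat_fst: "satisfies \<Sigma> X T (App (Mor p) [App (PairOp (p, q)) [Var x, Var y]], Var x, Cod A p)
      \<longleftrightarrow> (\<forall>v. v x \<in> carrier T (Cod A p) \<and> v y \<in> carrier T (Cod A q)
             \<longrightarrow> oper T (Mor p) [?pair (v x) (v y)] = v x)"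
    if "x \<in> X (Cod A p)" "y \<in> X (Cod A q)" for x y
    using that
    by (subst satisfies_two_vars[OF alg cone_eqs_sorted[OF c] obj(2) that(1) obj(3) that(2)])
      (auto simp: cone_eqs_def fst_eqs_def)
  have sat_snd: "satisfies \<Sigma> X T (App (Mor q) [App (PairOp (p, q)) [Var x, Var y]], Var y, Cod A q)
      \<longleftrightarrow> (\<forall>v. v x \<in> carrier T (Cod A p) \<and> v y \<in> carrier T (Cod A q)
             \<longrightarrow> oper T (Mor q) [?pair (v x) (v y)] = v y)"
    if "x \<in> X (Cod A p)" "y \<in> X (Cod A q)" for x y
    using that
    by (subst satisfies_two_vars[OF alg cone_eqs_sorted[OF c] obj(2) that(1) obj(3) that(2)])
      (auto simp: cone_eqs_def snd_eqs_def)
  have sat_eta: "satisfies \<Sigma> X T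
        (App (PairOp (p, q)) [App (Mor p) [Var z], App (Mor q) [Var z]], Var z, Dom A p) \<longleftrightarrow> ?eta"
    if "z \<in> X (Dom A p)" for z
    using that
    by (subst satisfies_one_var[OF alg cone_eqs_sorted[OF c] obj(1) that])
      (auto simp: cone_eqs_def pair_eqs_def dest: spec[where x = "\<lambda>_. _"])
  \<comment> \<open>Distinct even if both legs have the same codomain, so that their values can be chosen
    independently below.\<close>
  obtain x0 y0 where xy0: "x0 \<in> X (Cod A p)" "y0 \<in> X (Cod A q)" "x0 \<noteq> y0"
    using vars_distinct obj by blast
  obtain z0 where z0: "z0 \<in> X (Dom A p)" using vars_nonempty obj by blast
  have fst: "(\<forall>e \<in> fst_eqs A X (p, q). satisfies \<Sigma> X T e) \<longleftrightarrow> ?fst"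
  proof
    assume "\<forall>e \<in> fst_eqs A X (p, q). satisfies \<Sigma> X T e"
    then have sat0: "satisfies \<Sigma> X T
        (App (Mor p) [App (PairOp (p, q)) [Var x0, Var y0]], Var x0, Cod A p)"
      using xy0 unfolding fst_eqs_def by blast
    show ?fst
    proof (intro ballI)
      fix x y assume "x \<in> carrier T (Cod A p)" "y \<in> carrier T (Cod A q)"
      then show "oper T (Mor p) [?pair x y] = x"
        using sat0[unfolded sat_fst[OF xy0(1,2)], rule_format, of "(\<lambda>_. y)(x0 := x)"] xy0(3) by simp
    qed
  next
    assume ?fst
    then show "\<forall>e \<in> fst_eqs A X (p, q). satisfies \<Sigma> X T e"
      by (auto simp: fst_eqs_def sat_fst)
  qed
  have snd: "(\<forall>e \<in> snd_eqs A X (p, q). satisfies \<Sigma> X T e) \<longleftrightarrow> ?snd"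
  proof
    assume "\<forall>e \<in> snd_eqs A X (p, q). satisfies \<Sigma> X T e"
    then have sat0: "satisfies \<Sigma> X T
        (App (Mor q) [App (PairOp (p, q)) [Var x0, Var y0]], Var y0, Cod A q)"
      using xy0 unfolding snd_eqs_def by blast
    show ?snd
    proof (intro ballI)
      fix x y assume "x \<in> carrier T (Cod A p)" "y \<in> carrier T (Cod A q)"
      then show "oper T (Mor q) [?pair x y] = y"
        using sat0[unfolded sat_snd[OF xy0(1,2)], rule_format, of "(\<lambda>_. y)(x0 := x)"] xy0(3) by simp
    qed
  next
    assume ?snd
    then show "\<forall>e \<in> snd_eqs A X (p, q). satisfies \<Sigma> X T e"
      by (auto simp: snd_eqs_def sat_snd)
  qed
  have eta: "(\<forall>e \<in> pair_eqs A X (p, q). satisfies \<Sigma> X T e) \<longleftrightarrow> ?eta"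
    using z0 sat_eta unfolding pair_eqs_def by blast
  have "(\<forall>e \<in> cone_eqs A X (p, q). satisfies \<Sigma> X T e) \<longleftrightarrow> ?fst \<and> ?snd \<and> ?eta"
    using fst snd eta unfolding cone_eqs_def by blast
  also have "\<dots> \<longleftrightarrow> ?graph"
  proof
    assume "?fst \<and> ?snd \<and> ?eta"
    then show ?graph by metis
  next
    assume g: ?graph
    have pair: "?pair x y \<in> carrier T (Dom A p)"
      if "x \<in> carrier T (Cod A p)" "y \<in> carrier T (Cod A q)" for x y
      using oper_PairOp_in[OF alg c that] .
    have "oper T (Mor p) [z] \<in> carrier T (Cod A p)" "oper T (Mor q) [z] \<in> carrier T (Cod A q)"
      if "z \<in> carrier T (Dom A p)" for z
      using that pq by (auto intro: oper_Mor_in[OF alg])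
    with g pair show "?fst \<and> ?snd \<and> ?eta" by blast
  qed
  finally show ?thesis .
qed

lemma theory_algebra_open_iff:
  assumes ne: "\<And>a. a \<in> Obj A \<Longrightarrow> carrier T a \<noteq> {}"
  shows "theory_algebra_open A C X T \<longleftrightarrow> theory_algebra A C X T"
proof -
  have "satisfies_open \<Sigma> X T e \<longleftrightarrow> satisfies \<Sigma> X T e"
    if "is_algebra \<Sigma> T" "e \<in> theory_eqs A C X" for e
  proof -
    obtain l r s where e: "e = (l, r, s)" by (cases e)
    with that theory_eqs_sorted show ?thesis
      using satisfies_open_iff_satisfies[OF wf_signature that(1) vars_disjoint] ne by auto
  qed
  then show ?thesis
    unfolding theory_algebra_open_def theory_algebra_def by blast
qed

section \<open>From algebras to functors\<close>

lemma fobj_algebra_functor [simp]: "a \<in> Obj A \<Longrightarrow> fobj (algebra_functor A T) a = carrier T a"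
  by (simp add: algebra_functor_def)

lemma farr_algebra_functor:
  "f \<in> Arr A \<Longrightarrow> farr (algebra_functor A T) f =
    (carrier T (Dom A f), \<lambda>u\<in>carrier T (Dom A f). oper T (Mor f) [u], carrier T (Cod A f))"
  by (simp add: algebra_functor_def)

lemma cat_functor_algebra_functor_iff:
  assumes alg: "is_algebra \<Sigma> T"
  shows "cat_functor A Set_cat (algebra_functor A T) \<longleftrightarrow>
    (\<forall>e \<in> id_eqs A X \<union> comp_eqs A X. satisfies \<Sigma> X T e)"
proof -
  have obj: "fobj (algebra_functor A T) \<in> Obj A \<rightarrow>\<^sub>E Obj Set_cat"
    by (simp add: algebra_functor_def Set_cat_def)
  have arr: "farr (algebra_functor A T) \<in> Arr A \<rightarrow>\<^sub>E Arr Set_cat"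
    using oper_Mor_in[OF alg] by (auto simp: algebra_functor_def Set_cat_def)
  have bd: "Dom Set_cat (farr (algebra_functor A T) f) = fobj (algebra_functor A T) (Dom A f) \<and>
      Cod Set_cat (farr (algebra_functor A T) f) = fobj (algebra_functor A T) (Cod A f)"
    if "f \<in> Arr A" for f
    using that by (simp add: farr_algebra_functor Dom_in Cod_in) (simp add: Set_cat_def)
  have id: "farr (algebra_functor A T) (Id A a) = Id Set_cat (carrier T a) \<longleftrightarrow>
      (\<forall>u \<in> carrier T a. oper T (Mor (Id A a)) [u] = u)" if "a \<in> Obj A" for a
    using that
    by (auto simp: farr_algebra_functor Id_in Dom_Id Cod_Id Set_cat_def fun_eq_iff restrict_def)
  have comp: "farr (algebra_functor A T) (Comp A f g) =
        Comp Set_cat (farr (algebra_functor A T) f) (farr (algebra_functor A T) g) \<longleftrightarrow>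
      (\<forall>u \<in> carrier T (Dom A g).
         oper T (Mor (Comp A f g)) [u] = oper T (Mor f) [oper T (Mor g) [u]])"
    if "f \<in> Arr A" "g \<in> Arr A" "Dom A f = Cod A g" for f g
    using that oper_Mor_in[OF alg that(2)]
    by (auto simp: farr_algebra_functor Comp_in Dom_Comp Cod_Comp Set_cat_def compose_def
        fun_eq_iff restrict_def)
  have "cat_functor A Set_cat (algebra_functor A T) \<longleftrightarrow>
      (\<forall>a \<in> Obj A. \<forall>u \<in> carrier T a. oper T (Mor (Id A a)) [u] = u) \<and>
      (\<forall>f \<in> Arr A. \<forall>g \<in> Arr A. Dom A f = Cod A g \<longrightarrow> (\<forall>u \<in> carrier T (Dom A g).
         oper T (Mor (Comp A f g)) [u] = oper T (Mor f) [oper T (Mor g) [u]]))"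
    unfolding cat_functor_def by (simp add: obj arr bd id comp cong: ball_cong imp_cong)
  then show ?thesis
    unfolding satisfies_id_eqs_iff[OF alg, symmetric] satisfies_comp_eqs_iff[OF alg, symmetric]
    by blast
qed

lemma product_cone_algebra_functor_iff:
  assumes alg: "is_algebra \<Sigma> T" and c: "(p, q) \<in> C"
  shows "product_cone Set_cat (map_cone (algebra_functor A T) (p, q)) \<longleftrightarrow>
    (\<forall>x \<in> carrier T (Cod A p). \<forall>y \<in> carrier T (Cod A q).
       \<exists>!z. z \<in> carrier T (Dom A p) \<and> oper T (Mor p) [z] = x \<and> oper T (Mor q) [z] = y)"
proof -
  note pq = legs[OF c]
  have "(\<lambda>u\<in>carrier T (Dom A p). oper T (Mor p) [u]) \<in> carrier T (Dom A p) \<rightarrow>\<^sub>E carrier T (Cod A p)"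
    "(\<lambda>u\<in>carrier T (Dom A p). oper T (Mor q) [u]) \<in> carrier T (Dom A p) \<rightarrow>\<^sub>E carrier T (Cod A q)"
    using pq oper_Mor_in[OF alg] by (auto intro!: restrict_PiE_iff[THEN iffD2])
  moreover have "z \<in> carrier T (Dom A p) \<and>
      (\<lambda>u\<in>carrier T (Dom A p). oper T (Mor p) [u]) z = x \<and>
      (\<lambda>u\<in>carrier T (Dom A p). oper T (Mor q) [u]) z = y \<longleftrightarrow>
      z \<in> carrier T (Dom A p) \<and> oper T (Mor p) [z] = x \<and> oper T (Mor q) [z] = y" for x y z
    by auto
  ultimately show ?thesis
    using pq by (simp add: map_cone_def farr_algebra_functor product_cone_Set_cat_iff)
qed

lemma product_cone_if_cone_eqs:
  assumes alg: "is_algebra \<Sigma> T" and c: "c \<in> C" and sat: "\<forall>e \<in> cone_eqs A X c. satisfies \<Sigma> X T e"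
  shows "product_cone Set_cat (map_cone (algebra_functor A T) c)"
proof -
  obtain p q where pq: "c = (p, q)" by (cases c)
  note c' = c[unfolded pq]
  show ?thesis
    unfolding pq product_cone_algebra_functor_iff[OF alg c']
    using sat[unfolded pq satisfies_cone_eqs_iff[OF alg c']] oper_PairOp_in[OF alg c'] by metis
qed

lemma product_preserving_algebra_functor:
  assumes "theory_algebra A C X T"
  shows "product_preserving A C (algebra_functor A T)"
  using assms unfolding theory_algebra_def product_preserving_def theory_eqs_def
  by (auto simp: cat_functor_algebra_functor_iff intro!: product_cone_if_cone_eqs)

text \<open>The functor records the carriers and the unary operations. The cone equations make pairing the
  inverse of a map built from unary operations, so it is determined as well.\<close>

lemma algebra_functor_inj:
  assumes T: "theory_algebra A C X T" and T': "theory_algebra A C X T'"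
    and eq: "algebra_functor A T = algebra_functor A T'"
  shows "T = T'"
proof -
  have alg: "is_algebra \<Sigma> T" and alg': "is_algebra \<Sigma> T'"
    using T T' by (auto simp: theory_algebra_def)
  have carr: "carrier T a = carrier T' a" if "a \<in> Obj A" for a
    using eq fobj_algebra_functor[OF that] by metis
  have ext: "carrier T \<in> extensional (Obj A)" "carrier T' \<in> extensional (Obj A)"
    using alg alg' by (simp_all add: is_algebra_def)
  have carrier: "carrier T = carrier T'"
    by (rule extensionalityI[OF ext carr])
  have mor: "oper T (Mor f) [u] = oper T' (Mor f) [u]"
    if "f \<in> Arr A" "u \<in> carrier T (Dom A f)" for f u
  proof -
    have "farr (algebra_functor A T) f = farr (algebra_functor A T') f" by (simp only: eq)
    then have "(\<lambda>u\<in>carrier T (Dom A f). oper T (Mor f) [u])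
        = (\<lambda>u\<in>carrier T' (Dom A f). oper T' (Mor f) [u])"
      unfolding farr_algebra_functor[OF that(1)] prod.inject by (elim conjE)
    from fun_cong[OF this, of u] show ?thesis using that(2) by (simp add: carrier)
  qed
  have pair: "oper T (PairOp (p, q)) [x, y] = oper T' (PairOp (p, q)) [x, y]"
    if c: "(p, q) \<in> C" and xy: "x \<in> carrier T (Cod A p)" "y \<in> carrier T (Cod A q)" for p q x y
  proof -
    let ?z = "oper T' (PairOp (p, q)) [x, y]"
    have z: "?z \<in> carrier T (Dom A p)"
      using oper_PairOp_in[OF alg' c] xy by (simp add: carrier)
    have sat: "\<forall>e \<in> cone_eqs A X (p, q). satisfies \<Sigma> X T e"
      and sat': "\<forall>e \<in> cone_eqs A X (p, q). satisfies \<Sigma> X T' e"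
      using T T' c by (auto simp: theory_algebra_def theory_eqs_def)
    have "oper T' (Mor p) [?z] = x \<and> oper T' (Mor q) [?z] = y"
      using sat'[unfolded satisfies_cone_eqs_iff[OF alg' c]] xy z unfolding carrier by blast
    then have "oper T (Mor p) [?z] = x \<and> oper T (Mor q) [?z] = y"
      using mor z legs[OF c] by simp
    then show ?thesis
      using sat[unfolded satisfies_cone_eqs_iff[OF alg c]] xy z by blast
  qed
  have PiE: "oper T \<in> (\<Pi>\<^sub>E k\<in>Syms \<Sigma>. args \<Sigma> T k \<rightarrow>\<^sub>E carrier T (res \<Sigma> k))"
    "oper T' \<in> (\<Pi>\<^sub>E k\<in>Syms \<Sigma>. args \<Sigma> T' k \<rightarrow>\<^sub>E carrier T' (res \<Sigma> k))"
    using alg alg' by (simp_all add: is_algebra_def)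
  have args: "args \<Sigma> T' k = args \<Sigma> T k" for k
    by (simp add: args_def carrier)
  have "oper T = oper T'"
  proof (rule PiE_ext[OF PiE(1)])
    show "oper T' \<in> (\<Pi>\<^sub>E k\<in>Syms \<Sigma>. args \<Sigma> T k \<rightarrow>\<^sub>E carrier T (res \<Sigma> k))"
      using PiE(2) by (simp add: args carrier)
  next
    fix k assume k: "k \<in> Syms \<Sigma>"
    show "oper T k = oper T' k"
    proof (rule PiE_ext)
      show "oper T k \<in> args \<Sigma> T k \<rightarrow>\<^sub>E carrier T (res \<Sigma> k)"
        "oper T' k \<in> args \<Sigma> T k \<rightarrow>\<^sub>E carrier T (res \<Sigma> k)"
        using PiE_mem[OF PiE(1) k] PiE_mem[OF PiE(2) k] by (simp_all add: args carrier)
    next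
      fix as assume as: "as \<in> args \<Sigma> T k"
      from k show "oper T k as = oper T' k as"
        by (cases rule: Syms_cases)
          (use as in \<open>auto simp: in_args_iff list_all2_Cons2 intro: mor pair\<close>)
    qed
  qed
  with carrier show ?thesis by simp
qed

section \<open>From functors to algebras\<close>

abbreviation act where "act F f \<equiv> fst (snd (farr F f))"

text \<open>The definite description has a unique solution when \<open>F\<close> sends the cone to a product.\<close>

definition functor_algebra ::
  "('o, 'm, 'u set, 'u set_arr) functor_data \<Rightarrow> ('o, 'm sym, 'u) algebra" where
  "functor_algebra F = \<lparr>
     carrier = fobj F,
     oper = (\<lambda>k\<in>Syms \<Sigma>. \<lambda>as\<in>listset (map (fobj F) (arity \<Sigma> k)).
       case k of
         Mor f \<Rightarrow> act F f (as ! 0)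
       | PairOp (p, q) \<Rightarrow>
           THE z. z \<in> fobj F (Dom A p) \<and> act F p z = as ! 0 \<and> act F q z = as ! 1) \<rparr>"

lemma farr_eq:
  assumes "cat_functor A Set_cat F" "f \<in> Arr A"
  shows "farr F f = (fobj F (Dom A f), act F f, fobj F (Cod A f))"
    and "act F f \<in> fobj F (Dom A f) \<rightarrow>\<^sub>E fobj F (Cod A f)"
proof -
  obtain Y g Z where "farr F f = (Y, g, Z)" by (cases "farr F f")
  moreover have "farr F f \<in> Arr Set_cat" "Dom Set_cat (farr F f) = fobj F (Dom A f)"
    "Cod Set_cat (farr F f) = fobj F (Cod A f)"
    using assms by (auto simp: cat_functor_def)
  ultimately show "farr F f = (fobj F (Dom A f), act F f, fobj F (Cod A f))"
    and "act F f \<in> fobj F (Dom A f) \<rightarrow>\<^sub>E fobj F (Cod A f)"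
    by (auto simp: Set_cat_def)
qed

lemma carrier_functor_algebra [simp]: "carrier (functor_algebra F) = fobj F"
  by (simp add: functor_algebra_def)

lemma oper_functor_algebra_Mor:
  "\<lbrakk>f \<in> Arr A; u \<in> fobj F (Dom A f)\<rbrakk> \<Longrightarrow> oper (functor_algebra F) (Mor f) [u] = act F f u"
  by (simp add: functor_algebra_def in_listset_iff)

lemma oper_functor_algebra_PairOp:
  assumes F: "cat_functor A Set_cat F" and c: "(p, q) \<in> C"
    and cone: "product_cone Set_cat (map_cone F (p, q))"
    and xy: "x \<in> fobj F (Cod A p)" "y \<in> fobj F (Cod A q)"
  shows "oper (functor_algebra F) (PairOp (p, q)) [x, y] \<in> fobj F (Dom A p)" (is "?z \<in> _")
    and "z \<in> fobj F (Dom A p) \<Longrightarrow>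
      oper (functor_algebra F) (PairOp (p, q)) [x, y] = z \<longleftrightarrow> act F p z = x \<and> act F q z = y"
proof -
  let ?P = "\<lambda>z. z \<in> fobj F (Dom A p) \<and> act F p z = x \<and> act F q z = y"
  have "map_cone F (p, q) = ((fobj F (Dom A p), act F p, fobj F (Cod A p)),
      (fobj F (Dom A p), act F q, fobj F (Cod A q)))"
    using legs[OF c] farr_eq(1)[OF F, of p] farr_eq(1)[OF F, of q] by (simp add: map_cone_def)
  then have ex1: "\<exists>!z. ?P z"
    using cone xy by (simp add: product_cone_Set_cat_iff)
  have the: "?z = (THE z. ?P z)"
    using c xy by (simp add: functor_algebra_def set_Cons_def)
  have "?P ?z" unfolding the by (rule theI'[OF ex1])
  then show "?z \<in> fobj F (Dom A p)"
    and "z \<in> fobj F (Dom A p) \<Longrightarrow> ?z = z \<longleftrightarrow> act F p z = x \<and> act F q z = y"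
    using ex1 by blast+
qed

lemma is_algebra_functor_algebra:
  assumes F: "product_preserving A C F"
  shows "is_algebra \<Sigma> (functor_algebra F)"
  unfolding is_algebra_def
proof (intro conjI PiE_I)
  have Ffun: "cat_functor A Set_cat F" using F by (simp add: product_preserving_def)
  show "carrier (functor_algebra F) \<in> extensional (Sorts \<Sigma>)"
    using Ffun by (auto simp: cat_functor_def PiE_def)
  fix k as assume k: "k \<in> Syms \<Sigma>" and as: "as \<in> args \<Sigma> (functor_algebra F) k"
  from k show "oper (functor_algebra F) k as \<in> carrier (functor_algebra F) (res \<Sigma> k)"
  proof (cases rule: Syms_cases)
    case (Mor f)
    then show ?thesis
      using as farr_eq(2)[OF Ffun, of f]
      by (auto simp: in_args_iff list_all2_Cons2 oper_functor_algebra_Mor)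
  next
    case (PairOp p q)
    then have "product_cone Set_cat (map_cone F (p, q))"
      using F by (simp add: product_preserving_def)
    from oper_functor_algebra_PairOp(1)[OF Ffun PairOp(2) this] show ?thesis
      using as PairOp(1) by (auto simp: in_args_iff list_all2_Cons2)
  qed
qed (simp_all add: functor_algebra_def args_def)

lemma algebra_functor_functor_algebra:
  assumes F: "cat_functor A Set_cat F"
  shows "algebra_functor A (functor_algebra F) = F"
proof -
  have ext: "fobj F \<in> extensional (Obj A)" "farr F \<in> extensional (Arr A)"
    using F by (auto simp: cat_functor_def PiE_def)
  have obj: "fobj (algebra_functor A (functor_algebra F)) = fobj F"
    using ext(1) by (simp add: algebra_functor_def extensional_restrict)
  have "farr (algebra_functor A (functor_algebra F)) f = farr F f" if f: "f \<in> Arr A" for f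
  proof -
    have "(\<lambda>u\<in>fobj F (Dom A f). oper (functor_algebra F) (Mor f) [u])
        = restrict (act F f) (fobj F (Dom A f))"
      by (rule restrict_ext) (simp add: oper_functor_algebra_Mor f)
    also have "\<dots> = act F f"
      using farr_eq(2)[OF F f] by (simp add: PiE_restrict)
    finally show ?thesis
      using farr_eq(1)[OF F f] by (simp add: farr_algebra_functor[OF f])
  qed
  then have "farr (algebra_functor A (functor_algebra F)) = farr F"
    using ext(2) by (intro extensionalityI[of _ "Arr A"]) (auto simp: algebra_functor_def)
  with obj show ?thesis by simp
qed

lemma cone_eqs_functor_algebra:
  assumes F: "product_preserving A C F" and c: "c \<in> C"
  shows "\<forall>e \<in> cone_eqs A X c. satisfies \<Sigma> X (functor_algebra F) e"
proof -
  obtain p q where pq: "c = (p, q)" by (cases c)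
  note c' = c[unfolded pq]
  have Ffun: "cat_functor A Set_cat F" and cone: "product_cone Set_cat (map_cone F (p, q))"
    using F c' by (auto simp: product_preserving_def)
  show ?thesis
    unfolding pq satisfies_cone_eqs_iff[OF is_algebra_functor_algebra[OF F] c']
    using legs[OF c']
    by (auto simp: oper_functor_algebra_Mor oper_functor_algebra_PairOp(2)[OF Ffun c' cone])
qed

lemma theory_algebra_functor_algebra:
  assumes F: "product_preserving A C F"
  shows "theory_algebra A C X (functor_algebra F)"
proof -
  note alg = is_algebra_functor_algebra[OF F]
  have Ffun: "cat_functor A Set_cat F" using F by (simp add: product_preserving_def)
  have "cat_functor A Set_cat (algebra_functor A (functor_algebra F))"
    using Ffun by (simp add: algebra_functor_functor_algebra)
  then have "\<forall>e \<in> id_eqs A X \<union> comp_eqs A X. satisfies \<Sigma> X (functor_algebra F) e"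
    by (simp only: cat_functor_algebra_functor_iff[OF alg])
  with alg cone_eqs_functor_algebra[OF F] show ?thesis
    by (auto simp: theory_algebra_def theory_eqs_def)
qed

lemma bij_betw_algebra_functor:
  "bij_betw (algebra_functor A)
     {T :: ('o, 'm sym, 'u) algebra. theory_algebra A C X T} {F. product_preserving A C F}"
proof (rule bij_betw_byWitness[where f' = functor_algebra])
  show "\<forall>T \<in> {T :: ('o, 'm sym, 'u) algebra. theory_algebra A C X T}.
      functor_algebra (algebra_functor A T) = T"
  proof
    fix T :: "('o, 'm sym, 'u) algebra" assume "T \<in> {T. theory_algebra A C X T}"
    then have T: "theory_algebra A C X T" by simp
    note F = product_preserving_algebra_functor[OF T]
    then have "cat_functor A Set_cat (algebra_functor A T)" by (simp add: product_preserving_def)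
    then show "functor_algebra (algebra_functor A T) = T"
      by (intro algebra_functor_inj[OF theory_algebra_functor_algebra[OF F] T]
          algebra_functor_functor_algebra)
  qed
  show "\<forall>F \<in> {F :: ('o, 'm, 'u set, 'u set_arr) functor_data. product_preserving A C F}.
      algebra_functor A (functor_algebra F) = F"
    by (simp add: product_preserving_def algebra_functor_functor_algebra)
  show "algebra_functor A ` {T :: ('o, 'm sym, 'u) algebra. theory_algebra A C X T}
      \<subseteq> {F. product_preserving A C F}"
    by (rule image_subsetI) (simp add: product_preserving_algebra_functor)
  show "functor_algebra ` {F :: ('o, 'm, 'u set, 'u set_arr) functor_data. product_preserving A C F}
      \<subseteq> {T. theory_algebra A C X T}"
    by (rule image_subsetI) (simp add: theory_algebra_functor_algebra)
qed

lemma bij_betw_algebra_functor_nonempty: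
  "bij_betw (algebra_functor A)
     {T :: ('o, 'm sym, 'u) algebra.
        theory_algebra_open A C X T \<and> (\<forall>a \<in> Obj A. carrier T a \<noteq> {})}
     {F. product_preserving A C F \<and> (\<forall>a \<in> Obj A. fobj F a \<noteq> {})}"
proof (rule bij_betw_subset[OF bij_betw_algebra_functor])
  let ?nonempty = "\<lambda>F :: ('o, 'm, 'u set, 'u set_arr) functor_data. \<forall>a \<in> Obj A. fobj F a \<noteq> {}"
  have ne: "(\<forall>a \<in> Obj A. carrier T a \<noteq> {}) \<longleftrightarrow> ?nonempty (algebra_functor A T)"
    for T :: "('o, 'm sym, 'u) algebra"
    by simp
  have open_iff: "theory_algebra_open A C X T \<and> (\<forall>a \<in> Obj A. carrier T a \<noteq> {}) \<longleftrightarrow>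
      theory_algebra A C X T \<and> ?nonempty (algebra_functor A T)"
    for T :: "('o, 'm sym, 'u) algebra"
    using theory_algebra_open_iff[of T] by auto
  then have "algebra_functor A `
      {T :: ('o, 'm sym, 'u) algebra.
         theory_algebra_open A C X T \<and> (\<forall>a \<in> Obj A. carrier T a \<noteq> {})}
      = {F \<in> algebra_functor A ` {T :: ('o, 'm sym, 'u) algebra. theory_algebra A C X T}. ?nonempty F}"
    by (simp only:) blast
  also have "\<dots> = {F. product_preserving A C F \<and> ?nonempty F}"
    unfolding bij_betw_imp_surj_on[OF bij_betw_algebra_functor] by blast
  finally show "algebra_functor A `
      {T :: ('o, 'm sym, 'u) algebra.
         theory_algebra_open A C X T \<and> (\<forall>a \<in> Obj A. carrier T a \<noteq> {})}
      = {F. product_preserving A C F \<and> (\<forall>a \<in> Obj A. fobj F a \<noteq> {})}" .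
  show "{T :: ('o, 'm sym, 'u) algebra.
        theory_algebra_open A C X T \<and> (\<forall>a \<in> Obj A. carrier T a \<noteq> {})}
      \<subseteq> {T. theory_algebra A C X T}"
    unfolding open_iff by (rule Collect_mono) (rule impI, rule conjunct1)
qed

end

theorem mainTheorem2:
  fixes A :: "('o, 'm) category" and C :: "'m cone set" and X :: "'o \<Rightarrow> 'v set"
  assumes "category A"
    and "\<forall>c \<in> C. product_cone A c"
    and "variable_sets (cone_sig A C) X"
  shows
    "bij_betw (algebra_functor A)
       {T :: ('o, 'm sym, 'u) algebra. theory_algebra A C X T}
       {F. product_preserving A C F} \<and>
     bij_betw (algebra_functor A)
       {T :: ('o, 'm sym, 'u) algebra.
          theory_algebra_open A C X T \<and> (\<forall>a \<in> Obj A. carrier T a \<noteq> {})}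
       {F. product_preserving A C F \<and> (\<forall>a \<in> Obj A. fobj F a \<noteq> {})} \<and>
     (\<forall>T :: ('o, 'm sym, 'u) algebra.
        is_algebra (cone_sig A C) T \<and>
        (\<forall>e \<in> id_eqs A X \<union> comp_eqs A X. satisfies (cone_sig A C) X T e) \<longrightarrow>
        (\<forall>c \<in> C. (\<forall>e \<in> cone_eqs A X c. satisfies (cone_sig A C) X T e) \<longrightarrow>
           product_cone Set_cat (map_cone (algebra_functor A T) c))) \<and>
     (\<forall>F :: ('o, 'm, 'u set, 'u set_arr) functor_data. cat_functor A Set_cat F \<longrightarrow>
        (\<forall>c \<in> C. product_cone Set_cat (map_cone F c) \<longleftrightarrow>
           (\<exists>T. is_algebra (cone_sig A {c}) T \<and> algebra_functor A T = F \<and>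
                (\<forall>e \<in> cone_eqs A X c. satisfies (cone_sig A {c}) X T e))))"
proof -
  interpret category A by (rule assms(1))
  have legs: "p \<in> Arr A \<and> q \<in> Arr A \<and> Dom A q = Dom A p" if "(p, q) \<in> C" for p q
    using assms(2) that by (auto simp: product_cone_def)
  interpret cone_theory A C X
    by standard (use legs assms(3) in auto)
  have "product_cone Set_cat (map_cone F c) \<longleftrightarrow>
      (\<exists>T. is_algebra (cone_sig A {c}) T \<and> algebra_functor A T = F \<and>
         (\<forall>e \<in> cone_eqs A X c. satisfies (cone_sig A {c}) X T e))"
    if F: "cat_functor A Set_cat F" and c: "c \<in> C"
    for F :: "('o, 'm, 'u set, 'u set_arr) functor_data" and c
  proof -
    \<comment> \<open>The signature with pairing for the cone \<open>c\<close> alone has the same sorts, so the whole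
      development applies to it.\<close>
    interpret single: cone_theory A "{c}" X
    proof
      show "p \<in> Arr A \<and> q \<in> Arr A \<and> Dom A q = Dom A p" if "(p, q) \<in> {c}" for p q
        using legs c that by auto
      show "variable_sets (cone_sig A {c}) X"
        using assms(3) by (simp add: variable_sets_def cone_sig_def)
    qed
    show ?thesis
    proof
      assume "product_cone Set_cat (map_cone F c)"
      with F have "product_preserving A {c} F" by (simp add: product_preserving_def)
      then show "\<exists>T. is_algebra (cone_sig A {c}) T \<and> algebra_functor A T = F \<and>
          (\<forall>e \<in> cone_eqs A X c. satisfies (cone_sig A {c}) X T e)"
        using single.is_algebra_functor_algebra single.algebra_functor_functor_algebra[OF F]
          single.cone_eqs_functor_algebra by blast
    next
      assume "\<exists>T. is_algebra (cone_sig A {c}) T \<and> algebra_functor A T = F \<and>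
          (\<forall>e \<in> cone_eqs A X c. satisfies (cone_sig A {c}) X T e)"
      then show "product_cone Set_cat (map_cone F c)"
        using single.product_cone_if_cone_eqs by blast
    qed
  qed
  then show ?thesis
    using bij_betw_algebra_functor bij_betw_algebra_functor_nonempty product_cone_if_cone_eqs
    by blast
qed

end
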